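(* Let $N\ge 1$ be an integer, let $\omega(i)\in(0,1]$ for $1\le i\le N-1$, and consider the nearest neighbor random walk $\{X_n\}_{n\ge 0}$ on $\{0,1,\dots,N\}$ in the environment $\omega$ with reflection at the origin. Put $\rho_i=\frac{1-\omega(i)}{\omega(i)}$ for $1\le i\le N-1$. Then for every $x\in\{0,1,\dots,N\}$, the hitting time $T_N=\min\{n\ge 0 \mid X_n=N\}$ of the walk started at $x$ satisfies $$E_\omega^x(T_N)=N-x+2\sum_{i=x}^{N-1}\sum_{j=1}^{i}\prod_{k=j}^{i}\rho_k .$$ In particular, $$E_\omega^0(T_N)=N+2\sum_{i=1}^{N-1}\sum_{j=1}^{i}\prod_{k=j}^{i}\rho_k .$$
   Context: The walk in environment $\omega$ with reflection at the origin is the Markov chain on $\{0,1,\dots,N\}$ with $P(X_{n+1}=i+1\mid X_n=i)=\omega(i)$ and $P(X_{n+1}=i-1\mid X_n=i)=1-\omega(i)$ for $1\le i\le N-1$, and $P(X_{n+1}=1\mid X_n=0)=1$ (the behavior after reaching $N$ is irrelevant). $E_\omega^x$ denotes expectation for the walk started at $X_0=x$. Empty sums are $0$. *)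

theory Defs
  imports "HOL-Probability.Probability"
begin

text \<open>
  A time-homogeneous Markov chain \<open>X\<close> on a discrete state space \<open>S\<close>, started at \<open>x\<close>, with
  transition probabilities \<open>K\<close>, realised on an arbitrary probability space \<open>M\<close>.  The Markov property
  conditions on every finite history of positive probability, since \<^const>\<open>cond_prob\<close> is \<open>0\<close>
  when conditioning on a null event.
\<close>

definition markov_chain ::
    "'a measure \<Rightarrow> 's set \<Rightarrow> ('s \<Rightarrow> 's pmf) \<Rightarrow> 's \<Rightarrow> (nat \<Rightarrow> 'a \<Rightarrow> 's) \<Rightarrow> bool" where
  "markov_chain M S K x X \<longleftrightarrow>
     prob_space M \<and>
     (\<forall>s\<in>S. set_pmf (K s) \<subseteq> S) \<and>
     (\<forall>n. X n \<in> M \<rightarrow>\<^sub>M count_space S) \<and>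
     \<P>(w in M. X 0 w = x) = 1 \<and>
     (\<forall>n h j. \<P>(w in M. \<forall>m\<le>n. X m w = h m) > 0 \<longrightarrow>
        \<P>(w in M. X (Suc n) w = j \<bar> \<forall>m\<le>n. X m w = h m) = pmf (K (h n)) j)"

text \<open>
  The transition law out of \<open>N\<close> is left arbitrary: \<open>K N\<close> may be any distribution on \<open>{0..N}\<close>.
\<close>

definition reflected_walk ::
    "'a measure \<Rightarrow> nat \<Rightarrow> (nat \<Rightarrow> real) \<Rightarrow> nat \<Rightarrow> (nat \<Rightarrow> 'a \<Rightarrow> nat) \<Rightarrow> bool" where
  "reflected_walk M N \<omega> x X \<longleftrightarrow>
     (\<exists>K. markov_chain M {0..N} K x X \<and>
          (\<forall>i\<in>{1..N-1}. pmf (K i) (i + 1) = \<omega> i \<and> pmf (K i) (i - 1) = 1 - \<omega> i) \<and>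
          pmf (K 0) 1 = 1)"

text \<open>The hitting time is \<open>\<infinity>\<close> on paths that never visit \<open>y\<close>.\<close>

definition hitting_time :: "(nat \<Rightarrow> 'a \<Rightarrow> 's) \<Rightarrow> 's \<Rightarrow> 'a \<Rightarrow> enat" where
  "hitting_time X y w = Inf {enat n | n. X n w = y}"

definition expected_hitting_time :: "'a measure \<Rightarrow> (nat \<Rightarrow> 'a \<Rightarrow> 's) \<Rightarrow> 's \<Rightarrow> ennreal" where
  "expected_hitting_time M X y = (\<integral>\<^sup>+ w. ennreal_of_enat (hitting_time X y w) \<partial>M)"

definition rho :: "(nat \<Rightarrow> real) \<Rightarrow> nat \<Rightarrow> real" where
  "rho \<omega> i = (1 - \<omega> i) / \<omega> i"

end

theory Submission
  imports Defs
begin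

text \<open>
  Let \<open>g x\<close> be the claimed value.  It is nonnegative, vanishes at \<open>N\<close> and satisfies \<open>K g = g - 1\<close>
  on \<open>{0..<N}\<close>.  Hence \<open>b n = E(g (X n); T > n)\<close> obeys \<open>b (n + 1) = b n - P(T > n)\<close>, so the
  partial sums of \<open>\<Sum>n. P(T > n) = E(T)\<close> are \<open>g x - b n \<le> g x\<close>.  The series therefore converges,
  \<open>P(T > n)\<close> tends to \<open>0\<close>, and so does \<open>b n\<close>, because \<open>g\<close> is bounded.
\<close>

section \<open>One-step Markov property for events of the past\<close>

lemma measurable_count_space_eq_pred:
  assumes "X \<in> M \<rightarrow>\<^sub>M count_space S"
  shows "Measurable.pred M (\<lambda>w. X w = s)"
proof -
  have "{w\<in>space M. X w = s} = X -` ({s} \<inter> S) \<inter> space M"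
    using measurable_space[OF assms] by auto
  then show ?thesis
    using measurable_sets[OF assms, of "{s} \<inter> S"] by (simp add: pred_def)
qed

text \<open>The definition of \<open>markov_chain\<close> conditions only on single complete
  histories. Since \<open>S\<close> is finite, an event restricting the past splits into finitely
  many disjoint histories. All of them end in \<open>i\<close>, so each contributes the same factor
  \<open>pmf (K i) j\<close>.\<close>

lemma markov_chain_step:
  fixes X :: "nat \<Rightarrow> 'a \<Rightarrow> 's"
  assumes mc: "markov_chain M S K x X" and fin: "finite S"
  shows "\<P>(w in M. (\<forall>m\<le>n. X m w \<in> B m) \<and> X n w = i \<and> X (Suc n) w = j) =
         \<P>(w in M. (\<forall>m\<le>n. X m w \<in> B m) \<and> X n w = i) * pmf (K i) j"
proof -
  interpret prob_space M using mc by (simp add: markov_chain_def)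
  have X: "\<And>n. X n \<in> M \<rightarrow>\<^sub>M count_space S"
    using mc by (simp add: markov_chain_def)
  have XS: "X m w \<in> S" if "w \<in> space M" for m w
    using measurable_space[OF X that] by simp
  note [measurable] = measurable_count_space_eq_pred[OF X]
  \<comment> \<open>Intersecting with \<open>S\<close> makes the set of histories finite.
    Extensionality on \<open>{..n}\<close> forces distinct histories to differ at some time up to
    \<open>n\<close>, so their events are disjoint.\<close>
  define F where "F = {h \<in> PiE {..n} (\<lambda>m. B m \<inter> S). h n = i}"
  define E where "E h = {w\<in>space M. \<forall>m\<le>n. X m w = h m}" for h
  define J where "J = {w\<in>space M. X (Suc n) w = j}"
  have E[measurable]: "E h \<in> events" for h unfolding E_def by measurable
  have J[measurable]: "J \<in> events" unfolding J_def by measurable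
  have finF: "finite F"
    unfolding F_def using fin by (intro finite_subset[OF Collect_restrict] finite_PiE) auto
  have disj: "disjoint_family_on E F"
  proof (unfold disjoint_family_on_def, intro ballI impI)
    fix h h' assume h: "h \<in> F" "h' \<in> F" "h \<noteq> h'"
    then obtain m where "m \<le> n" "h m \<noteq> h' m"
      unfolding F_def by (auto dest: PiE_ext)
    then show "E h \<inter> E h' = {}" by (auto simp: E_def)
  qed
  have disjJ: "disjoint_family_on (\<lambda>h. E h \<inter> J) F"
    using disj by (auto simp: disjoint_family_on_def)
  have union: "{w\<in>space M. (\<forall>m\<le>n. X m w \<in> B m) \<and> X n w = i} = (\<Union>h\<in>F. E h)"
  proof (intro equalityI subsetI)
    fix w assume w: "w \<in> {w\<in>space M. (\<forall>m\<le>n. X m w \<in> B m) \<and> X n w = i}"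
    then have "restrict (\<lambda>m. X m w) {..n} \<in> F" "w \<in> E (restrict (\<lambda>m. X m w) {..n})"
      by (auto simp: F_def E_def XS)
    then show "w \<in> (\<Union>h\<in>F. E h)" by blast
  qed (auto simp: F_def E_def PiE_def Pi_def)
  have step: "prob (E h \<inter> J) = prob (E h) * pmf (K i) j" if "h \<in> F" for h
  \<comment> \<open>The Markov property says nothing about null histories; for these both sides
    vanish.\<close>
  proof (cases "prob (E h) = 0")
    case True
    moreover have "prob (E h \<inter> J) \<le> prob (E h)" by (intro finite_measure_mono) auto
    ultimately show ?thesis by (simp add: measure_le_0_iff)
  next
    case False
    then have "prob (E h) > 0" by (simp add: zero_less_measure_iff)
    moreover have "h n = i" using that by (simp add: F_def)
    ultimately have "\<P>(w in M. X (Suc n) w = j \<bar> \<forall>m\<le>n. X m w = h m) = pmf (K i) j"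
      using mc unfolding markov_chain_def E_def by blast
    moreover have "{w \<in> space M. X (Suc n) w = j \<and> (\<forall>m\<le>n. X m w = h m)} = E h \<inter> J"
      by (auto simp: E_def J_def)
    ultimately show ?thesis
      using False by (simp add: cond_prob_def flip: E_def) (simp add: field_simps)
  qed
  have "{w\<in>space M. (\<forall>m\<le>n. X m w \<in> B m) \<and> X n w = i \<and> X (Suc n) w = j} = (\<Union>h\<in>F. E h) \<inter> J"
    unfolding union[symmetric] J_def by auto
  then have "\<P>(w in M. (\<forall>m\<le>n. X m w \<in> B m) \<and> X n w = i \<and> X (Suc n) w = j) = prob (\<Union>h\<in>F. E h \<inter> J)"
    by (simp add: Int_UN_distrib2)
  also have "\<dots> = (\<Sum>h\<in>F. prob (E h \<inter> J))"
    using finF disjJ by (intro finite_measure_finite_Union) auto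
  also have "\<dots> = (\<Sum>h\<in>F. prob (E h)) * pmf (K i) j"
    by (simp add: step sum_distrib_right)
  also have "(\<Sum>h\<in>F. prob (E h)) = prob (\<Union>h\<in>F. E h)"
    using finF disj by (intro finite_measure_finite_Union[symmetric]) auto
  finally show ?thesis by (simp add: union)
qed

section \<open>Hitting times: measurability and the tail sum\<close>

lemma less_hitting_time_iff:
  "enat n < hitting_time X y w \<longleftrightarrow> (\<forall>m\<le>n. X m w \<noteq> y)"
proof
  assume *: "\<forall>m\<le>n. X m w \<noteq> y"
  have "enat (Suc n) \<le> hitting_time X y w"
    unfolding hitting_time_def using * by (auto intro!: Inf_greatest) (metis not_less_eq_eq)
  then show "enat n < hitting_time X y w"
    by (metis Suc_ile_eq)
next
  assume *: "enat n < hitting_time X y w"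
  show "\<forall>m\<le>n. X m w \<noteq> y"
  proof (intro allI impI notI)
    fix m assume "m \<le> n" "X m w = y"
    then have "hitting_time X y w \<le> enat m"
      unfolding hitting_time_def by (auto intro!: Inf_lower)
    with * \<open>m \<le> n\<close> show False by (meson enat_ord_simps(1) leD order_trans)
  qed
qed

text \<open>The type \<open>enat\<close> is countable, so preimages of singletons suffice. An
  extended natural is determined by the finite numbers strictly below it, which turns
  \<open>hitting_time X y w = t\<close> into countably many avoidance events.\<close>

lemma borel_measurable_hitting_time:
  assumes [measurable]: "\<And>n. Measurable.pred M (\<lambda>w. X n w = y)"
  shows "hitting_time X y \<in> M \<rightarrow>\<^sub>M count_space UNIV"
proof (subst measurable_count_space_eq2_countable, intro conjI ballI)
  have gt: "Measurable.pred M (\<lambda>w. enat n < hitting_time X y w)" for n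
    unfolding less_hitting_time_iff by measurable
  note gt[measurable]
  \<comment> \<open>If the two differ, the smaller one is finite and itself separates them.\<close>
  have ext: "s = t" if "\<forall>n. enat n < t \<longleftrightarrow> enat n < s" for s t :: enat
  proof (rule linorder_cases[of s t])
    assume "s < t"
    moreover from this obtain k where "s = enat k" by (cases s) auto
    ultimately show ?thesis using that by auto
  next
    assume "t < s"
    moreover from this obtain k where "t = enat k" by (cases t) auto
    ultimately show ?thesis using that by auto
  qed
  then have eq: "hitting_time X y w = t \<longleftrightarrow>
      (\<forall>n. enat n < t \<longleftrightarrow> enat n < hitting_time X y w)" for w t
    by blast
  fix t :: enat
  have "Measurable.pred M (\<lambda>w. hitting_time X y w = t)"
    unfolding eq by measurable
  moreover have "hitting_time X y -` {t} \<inter> space M = {w\<in>space M. hitting_time X y w = t}"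
    by auto
  ultimately show "hitting_time X y -` {t} \<inter> space M \<in> sets M"
    by (simp add: pred_def)
qed auto

text \<open>This is the tail formula \<open>E(T) = (\<Sum>n. P(T > n))\<close>. It holds in
  \<open>ennreal\<close>, so finiteness of the expectation need not be known beforehand.\<close>

lemma expected_hitting_time_eq_suminf:
  assumes [measurable]: "\<And>n. Measurable.pred M (\<lambda>w. X n w = y)"
  shows "expected_hitting_time M X y = (\<Sum>n. emeasure M {w\<in>space M. \<forall>m\<le>n. X m w \<noteq> y})"
  unfolding expected_hitting_time_def
  by (subst nn_integral_enat_function[OF borel_measurable_hitting_time[OF assms]])
     (simp add: less_hitting_time_iff)

section \<open>Expected hitting times of finite chains from a potential\<close>

lemma expected_hitting_time_finite_markov_chain:
  fixes g :: "'s \<Rightarrow> real"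
  assumes mc: "markov_chain M S K x X" and fin: "finite S" and x: "x \<in> S"
    and g_nonneg: "\<And>s. s \<in> S \<Longrightarrow> g s \<ge> 0" and gy: "g y = 0"
    and g_step: "\<And>s. s \<in> S \<Longrightarrow> s \<noteq> y \<Longrightarrow> (\<Sum>t\<in>S. pmf (K s) t * g t) = g s - 1"
  shows "expected_hitting_time M X y = ennreal (g x)"
proof -
  interpret prob_space M using mc by (simp add: markov_chain_def)
  have X: "\<And>n. X n \<in> M \<rightarrow>\<^sub>M count_space S"
    using mc by (simp add: markov_chain_def)
  have XS: "X m w \<in> S" if "w \<in> space M" for m w
    using measurable_space[OF X that] by simp
  note [measurable] = measurable_count_space_eq_pred[OF X]
  define A where "A n = {w\<in>space M. \<forall>m\<le>n. X m w \<noteq> y}" for n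
  \<comment> \<open>The law at time \<open>n\<close> of the chain killed on reaching
    \<open>y\<close>; avoidance is written as membership in \<open>- {y}\<close> to match the sets
    \<open>B m\<close> of \<open>markov_chain_step\<close>.\<close>
  define p where "p n s = prob {w\<in>space M. (\<forall>m\<le>n. X m w \<in> - {y}) \<and> X n w = s}" for n s
  define b where "b n = (\<Sum>s\<in>S. p n s * g s)" for n
  have [measurable]: "A n \<in> events" for n unfolding A_def by measurable
  have split_state: "prob C = (\<Sum>s\<in>S. prob {w\<in>C. X n w = s})" if C: "C \<in> events" for C n
  proof -
    have "C = (\<Union>s\<in>S. {w\<in>C. X n w = s})"
      using XS sets.sets_into_space[OF C] by auto
    also have "prob \<dots> = (\<Sum>s\<in>S. prob {w\<in>C. X n w = s})"
    proof (intro finite_measure_finite_Union fin)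
      have "{w\<in>C. X n w = s} = C \<inter> {w\<in>space M. X n w = s}" for s
        using sets.sets_into_space[OF C] by auto
      then show "(\<lambda>s. {w\<in>C. X n w = s}) ` S \<subseteq> events" using C by auto
    qed (auto simp: disjoint_family_on_def)
    finally show ?thesis .
  qed
  have A_sum: "prob (A n) = (\<Sum>s\<in>S. p n s)" for n
    by (subst split_state[of _ n]) (auto simp: A_def p_def intro!: sum.cong arg_cong[where f=prob])
  have p_y: "p n y = 0" for n
  proof -
    have "{w\<in>space M. (\<forall>m\<le>n. X m w \<in> - {y}) \<and> X n w = y} = {}" by auto
    then show ?thesis unfolding p_def by (simp only: measure_empty)
  qed
  have p_Suc: "p (Suc n) t = (\<Sum>s\<in>S. p n s * pmf (K s) t)" if "t \<noteq> y" for n t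
  proof -
    define C where "C = {w\<in>space M. (\<forall>m\<le>n. X m w \<in> - {y}) \<and> X (Suc n) w = t}"
    have [measurable]: "C \<in> events" unfolding C_def by simp
    have "p (Suc n) t = prob C"
      unfolding p_def C_def using that
      by (intro arg_cong[where f=prob]) (auto simp: le_Suc_eq)
    also have "\<dots> = (\<Sum>s\<in>S. prob {w\<in>C. X n w = s})"
      by (intro split_state) simp
    also have "\<dots> = (\<Sum>s\<in>S. p n s * pmf (K s) t)"
      unfolding p_def markov_chain_step[OF mc fin, symmetric]
      by (auto simp: C_def intro!: sum.cong arg_cong[where f=prob])
    finally show ?thesis .
  qed
  \<comment> \<open>The target is harmless twice: mass stepping into \<open>y\<close> is killed but
    would carry weight \<open>g y = 0\<close>, and no mass leaves \<open>y\<close> because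
    \<open>p n y = 0\<close>, so \<open>g_step\<close> is applied only away from
    \<open>y\<close>.\<close>
  have b_Suc: "b (Suc n) = b n - prob (A n)" for n
  proof -
    have "b (Suc n) = (\<Sum>t\<in>S. \<Sum>s\<in>S. p n s * (pmf (K s) t * g t))"
      unfolding b_def
    proof (intro sum.cong refl)
      fix t show "p (Suc n) t * g t = (\<Sum>s\<in>S. p n s * (pmf (K s) t * g t))"
        by (cases "t = y") (simp_all add: gy p_Suc sum_distrib_right mult.assoc)
    qed
    also have "\<dots> = (\<Sum>s\<in>S. p n s * (\<Sum>t\<in>S. pmf (K s) t * g t))"
      by (subst sum.swap) (simp add: sum_distrib_left)
    also have "\<dots> = (\<Sum>s\<in>S. p n s * (g s - 1))"
    proof (intro sum.cong refl)
      fix s assume "s \<in> S"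
      then show "p n s * (\<Sum>t\<in>S. pmf (K s) t * g t) = p n s * (g s - 1)"
        by (cases "s = y") (simp_all add: p_y g_step)
    qed
    finally show ?thesis
      by (simp add: b_def A_sum right_diff_distrib sum_subtractf)
  qed
  have X0: "AE w in M. X 0 w = x"
    using mc by (intro AE_I_eq_1) (auto simp: markov_chain_def emeasure_eq_measure)
  have p_0: "p 0 s = (if s = x \<and> s \<noteq> y then 1 else 0)" for s
  proof -
    have "p 0 s = prob {w\<in>space M. s = x \<and> s \<noteq> y}"
      unfolding p_def using X0 by (intro finite_measure_eq_AE) auto
    then show ?thesis by (cases "s = x \<and> s \<noteq> y") (auto simp: prob_space)
  qed
  have b_0: "b 0 = g x"
  proof -
    have "b 0 = (\<Sum>s\<in>S. if s = x then g x else 0)"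
      unfolding b_def by (intro sum.cong) (auto simp: p_0 gy)
    then show ?thesis using fin x by simp
  qed
  have b_nonneg: "b n \<ge> 0" for n
    unfolding b_def p_def by (intro sum_nonneg mult_nonneg_nonneg g_nonneg) auto
  have partial: "(\<Sum>k<n. prob (A k)) = g x - b n" for n
    by (induction n) (simp_all add: b_0 b_Suc)
  have summable: "summable (\<lambda>n. prob (A n))"
    by (rule summableI_nonneg_bounded[where x="g x"]) (simp_all add: partial b_nonneg)
  \<comment> \<open>As \<open>g\<close> is nonnegative on the finite set \<open>S\<close>, its sum
    over \<open>S\<close> serves as an upper bound for each value.\<close>
  have b_le: "b n \<le> (\<Sum>s\<in>S. g s) * prob (A n)" for n
  proof -
    have "b n \<le> (\<Sum>s\<in>S. p n s * (\<Sum>s\<in>S. g s))"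
      unfolding b_def p_def
      by (intro sum_mono mult_left_mono member_le_sum g_nonneg fin) auto
    then show ?thesis by (simp add: A_sum sum_distrib_right mult.commute sum_distrib_left)
  qed
  have "(\<lambda>n. (\<Sum>s\<in>S. g s) * prob (A n)) \<longlonglongrightarrow> 0"
    using summable_LIMSEQ_zero[OF summable] by (rule tendsto_mult_right_zero)
  then have "b \<longlonglongrightarrow> 0"
    by (rule tendsto_sandwich[rotated 3]) (auto simp: b_nonneg b_le)
  then have "(\<lambda>n. g x - b n) \<longlonglongrightarrow> g x"
    by (auto intro: tendsto_eq_intros)
  then have "(\<lambda>n. prob (A n)) sums g x"
    by (simp add: sums_def partial)
  then have "(\<Sum>n. ennreal (prob (A n))) = ennreal (g x)"
    by (intro suminf_ennreal_eq) auto
  then show ?thesis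
    by (simp add: expected_hitting_time_eq_suminf A_def emeasure_eq_measure)
qed

section \<open>The potential of the reflected walk\<close>

lemma sum_prod_rho_step:
  assumes "1 \<le> i"
  shows "(\<Sum>j=1..i. \<Prod>k=j..i. rho \<omega> k) = rho \<omega> i * (1 + (\<Sum>j=1..i-1. \<Prod>k=j..i-1. rho \<omega> k))"
proof -
  obtain m where i: "i = Suc m" using assms by (cases i) auto
  show ?thesis
    by (simp add: i sum_distrib_left algebra_simps)
qed

text \<open>The weights of \<open>a\<close> and \<open>b\<close> already exhaust the total mass 1,
  so every third point has weight 0.\<close>

lemma sum_pmf_two_points:
  assumes ab: "a \<noteq> b" "pmf q a + pmf q b = 1" and S: "finite S" "a \<in> S" "b \<in> S"
  shows "(\<Sum>t\<in>S. pmf q t * g t) = pmf q a * g a + pmf q b * (g b :: real)"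
proof -
  have "pmf q t = 0" if "t \<noteq> a" "t \<noteq> b" for t
  proof -
    have "measure (measure_pmf q) {t, a, b} \<le> 1" by simp
    then have "pmf q t + (pmf q a + pmf q b) \<le> 1"
      using that ab by (simp add: measure_measure_pmf_finite)
    then show ?thesis using ab by (simp add: antisym)
  qed
  then have "(\<Sum>t\<in>S. pmf q t * g t) = (\<Sum>t\<in>{a, b}. pmf q t * g t)"
    using S by (intro sum.mono_neutral_right) auto
  then show ?thesis using ab by simp
qed

lemma expected_hitting_time_reflected_walk:
  assumes N: "N \<ge> 1" and \<omega>: "\<And>i. i \<in> {1..N-1} \<Longrightarrow> 0 < \<omega> i \<and> \<omega> i \<le> 1"
    and x: "x \<le> N" and walk: "reflected_walk M N \<omega> x X"
  shows "expected_hitting_time M X N =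
    ennreal (real N - real x + 2 * (\<Sum>i=x..N-1. \<Sum>j=1..i. \<Prod>k=j..i. rho \<omega> k))"
proof -
  \<comment> \<open>In the potential, \<open>1 + 2 * c i\<close> is the expected time to pass from
    \<open>i\<close> to \<open>i + 1\<close>; \<open>g s\<close> adds these over \<open>i\<close>
    from \<open>s\<close> to \<open>N - 1\<close>.\<close>
  define c where "c i = (\<Sum>j=1..i. \<Prod>k=j..i. rho \<omega> k)" for i
  define g where "g s = real N - real s + 2 * (\<Sum>i=s..N-1. c i)" for s
  obtain K where mc: "markov_chain M {0..N} K x X"
    and K: "\<And>i. i \<in> {1..N-1} \<Longrightarrow> pmf (K i) (i + 1) = \<omega> i \<and> pmf (K i) (i - 1) = 1 - \<omega> i"
    and K0: "pmf (K 0) 1 = 1"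
    using walk unfolding reflected_walk_def by blast
  have rho_nonneg: "rho \<omega> i \<ge> 0" if "i \<in> {1..N-1}" for i
    using \<omega>[OF that] by (simp add: rho_def)
  have c_nonneg: "c i \<ge> 0" if "i \<le> N - 1" for i
    unfolding c_def using that by (intro sum_nonneg prod_nonneg ballI rho_nonneg) auto
  have g_nonneg: "g s \<ge> 0" if "s \<in> {0..N}" for s
    unfolding g_def using that
    by (intro add_nonneg_nonneg mult_nonneg_nonneg sum_nonneg c_nonneg) auto
  have gN: "g N = 0" using N by (simp add: g_def)
  have g_rec: "g s = 1 + 2 * c s + g (Suc s)" if "s < N" for s
    using that by (simp add: g_def sum.atLeast_Suc_atMost algebra_simps)
  have g_step: "(\<Sum>t\<in>{0..N}. pmf (K s) t * g t) = g s - 1" if "s \<in> {0..N}" "s \<noteq> N" for s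
  proof (cases "s = 0")
    \<comment> \<open>Reflection leaves no mass at 0, so the two-point sum with 0 and 1 is just
      \<open>g 1\<close>. Since \<open>c 0\<close> is an empty sum,
      \<open>g 0 = 1 + g 1\<close>.\<close>
    case True
    have "pmf (K 0) 0 + pmf (K 0) 1 = measure (measure_pmf (K 0)) {0, 1}"
      by (simp add: measure_measure_pmf_finite)
    also have "\<dots> \<le> 1" by simp
    finally have "pmf (K 0) 0 = 0" using K0 by (simp add: antisym)
    then show ?thesis
      using sum_pmf_two_points[of 0 1 "K 0" "{0..N}" g] K0 N g_rec[of 0] True
      by (simp add: c_def)
  next
    case False
    then have s: "s \<in> {1..N-1}" using that by auto
    \<comment> \<open>Factoring \<open>rho \<omega> s\<close> out of every product leaves an empty
      product at \<open>j = s\<close>, the source of the 1. Multiplied by \<open>\<omega> s\<close>,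
      this recursion is exactly what cancels the \<open>c\<close> terms when the two neighbours of
      \<open>s\<close> are averaged.\<close>
    have c_rec: "\<omega> s * c s = (1 - \<omega> s) * (1 + c (s - 1))"
      using sum_prod_rho_step[of s \<omega>] s \<omega>[OF s] by (simp add: c_def rho_def)
    have g_pred: "g (s - 1) = 1 + 2 * c (s - 1) + g s"
      using g_rec[of "s - 1"] s by auto
    have g_succ: "g (s + 1) = g s - 1 - 2 * c s"
      using g_rec[of s] s by auto
    have "(\<Sum>t\<in>{0..N}. pmf (K s) t * g t) = \<omega> s * g (s + 1) + (1 - \<omega> s) * g (s - 1)"
      using sum_pmf_two_points[of "s + 1" "s - 1" "K s" "{0..N}" g] K[OF s] s by auto
    also have "\<dots> = g s - 1"
      unfolding g_pred g_succ using c_rec by (simp add: algebra_simps)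
    finally show ?thesis .
  qed
  have "expected_hitting_time M X N = ennreal (g x)"
    using x by (intro expected_hitting_time_finite_markov_chain[OF mc] g_nonneg gN g_step) auto
  then show ?thesis by (simp add: g_def c_def)
qed

theorem proposition1:
  fixes N :: nat and \<omega> :: "nat \<Rightarrow> real"
  assumes "N \<ge> 1"
    and "\<And>i. i \<in> {1..N-1} \<Longrightarrow> 0 < \<omega> i \<and> \<omega> i \<le> 1"
  shows "(\<forall>x\<in>{0..N}. \<forall>(M :: 'a measure) X. reflected_walk M N \<omega> x X \<longrightarrow>
            expected_hitting_time M X N =
              ennreal (real N - real x + 2 * (\<Sum>i=x..N-1. \<Sum>j=1..i. \<Prod>k=j..i. rho \<omega> k))) \<and>
         (\<forall>(M :: 'a measure) X. reflected_walk M N \<omega> 0 X \<longrightarrow>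
            expected_hitting_time M X N =
              ennreal (real N + 2 * (\<Sum>i=1..N-1. \<Sum>j=1..i. \<Prod>k=j..i. rho \<omega> k)))"
proof (intro conjI ballI allI impI)
  fix x and M :: "'a measure" and X
  assume "x \<in> {0..N}" "reflected_walk M N \<omega> x X"
  then show "expected_hitting_time M X N =
      ennreal (real N - real x + 2 * (\<Sum>i=x..N-1. \<Sum>j=1..i. \<Prod>k=j..i. rho \<omega> k))"
    using expected_hitting_time_reflected_walk[where x=x and M=M and X=X, OF assms] by simp
next
  fix M :: "'a measure" and X
  assume "reflected_walk M N \<omega> 0 X"
  \<comment> \<open>Starting from 0, the outer sum also contains \<open>i = 0\<close>; its inner sum
    is empty, so the range may begin at 1.\<close>
  then show "expected_hitting_time M X N =
      ennreal (real N + 2 * (\<Sum>i=1..N-1. \<Sum>j=1..i. \<Prod>k=j..i. rho \<omega> k))"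
    using expected_hitting_time_reflected_walk[where x=0 and M=M and X=X, OF assms]
    by (simp add: sum.atLeast_Suc_atMost)
qed

end
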